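(* Let $\sigma>0$, let $k$ be a positive integer, and let $\mathbf B_{(k)}=[B_{(1)},\dots,B_{(k)}]$ be the $k$ smallest values, in increasing order $B_{(1)}\le\dots\le B_{(k)}$, of a real-valued sample, with $B_{(1)},\dots,B_{(k)}$ not all equal. Let $\mathbf Y_{(k)}=[Y_{(1)},\dots,Y_{(k)}]$ be the corresponding ordered values of the sample rescaled by $\sigma$, i.e. $Y_{(i)}=\sigma B_{(i)}$ for $1\le i\le k$. Then $$\gamma(\mathbf Y_{(k)})=\gamma(\mathbf B_{(k)}).$$
   Context: For an ordered real vector $\mathbf y_{(k)}=[y_{(1)},\dots,y_{(k)}]$ with $y_{(1)}\le\dots\le y_{(k)}$, define $$\gamma(\mathbf y_{(k)})=\frac{s^2}{(\bar y-y_{(k)})^2},\qquad \bar y=\frac1k\sum_{i=1}^k y_{(i)},\qquad s^2=\frac1k\sum_{i=1}^k (y_{(i)}-\bar y)^2 .$$ This is well defined (nonzero denominator) exactly when the entries are not all equal. *)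

theory Defs
  imports Complex_Main "HOL-Library.Multiset"
begin

definition mean :: "real list \<Rightarrow> real" where
  "mean y = (\<Sum>i<length y. y ! i) / real (length y)"

text \<open>Normalised by \<open>k\<close>, not by \<open>k - 1\<close>.\<close>

definition variance :: "real list \<Rightarrow> real" where
  "variance y = (\<Sum>i<length y. (y ! i - mean y)\<^sup>2) / real (length y)"

text \<open>
  An ordered vector of length \<open>k\<close> is a sorted list, whose 0-based entry \<open>y ! (k - 1)\<close>
  is the largest value.  The quotient is meaningful only if the entries are not all equal.
\<close>

definition gamma :: "real list \<Rightarrow> real" where
  "gamma y = variance y / (mean y - y ! (length y - 1))\<^sup>2"

definition k_smallest :: "nat \<Rightarrow> real list \<Rightarrow> real list" where
  "k_smallest k sample = take k (sort sample)"

lemma k_smallest_scale: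
  assumes "\<sigma> > 0" "k \<le> length sample" "i < k"
  shows "k_smallest k (map (\<lambda>x. \<sigma> * x) sample) ! i = \<sigma> * k_smallest k sample ! i"
proof -
  have "sorted (map (\<lambda>x. \<sigma> * x) (sort sample))"
    using assms(1) by (auto simp: sorted_map intro: sorted_wrt_mono_rel[OF _ sorted_sort])
  then have "sort (map (\<lambda>x. \<sigma> * x) sample) = map (\<lambda>x. \<sigma> * x) (sort sample)"
    by (intro properties_for_sort) simp_all
  then show ?thesis
    using assms(2,3) by (simp add: k_smallest_def)
qed

end

theory Submission
  imports Defs
begin

text \<open>Under scaling by \<open>c\<close> the mean is homogeneous of degree 1 and the variance
  of degree 2 (\<open>mean_map_mult\<close>, \<open>variance_map_mult\<close>), so their quotient
  \<open>gamma\<close> has degree 0 (\<open>gamma_map_mult\<close>). Multiplication by \<sigma> > 0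
  preserves order, so it commutes with selecting the \<open>k\<close> smallest values, and
  \<open>Y\<close> is \<open>B\<close> scaled by \<sigma>.\<close>

lemma mean_map_mult: "mean (map (\<lambda>x. c * x) y) = c * mean y"
  by (simp add: mean_def flip: sum_distrib_left)

lemma variance_map_mult: "variance (map (\<lambda>x. c * x) y) = c\<^sup>2 * variance y"
proof -
  have "(\<Sum>i<length y. (c * y ! i - c * mean y)\<^sup>2) = c\<^sup>2 * (\<Sum>i<length y. (y ! i - mean y)\<^sup>2)"
    by (simp add: sum_distrib_left flip: right_diff_distrib power_mult_distrib)
  then show ?thesis
    by (simp add: variance_def mean_map_mult)
qed

lemma gamma_map_mult:
  assumes "c \<noteq> 0" "y \<noteq> []"
  shows "gamma (map (\<lambda>x. c * x) y) = gamma y"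
proof -
  \<comment> \<open>Since \<open>y\<close> is nonempty, the index \<open>length y - 1\<close> is in
    bounds and the last entry also scales by \<open>c\<close>; squaring then gives the factor
    \<open>c\<^sup>2\<close> that cancels against the one from the variance.\<close>
  have "mean (map (\<lambda>x. c * x) y) - map (\<lambda>x. c * x) y ! (length y - 1)
      = c * (mean y - y ! (length y - 1))"
    using assms(2) by (simp add: mean_map_mult right_diff_distrib)
  then show ?thesis
    using assms(1) by (simp add: gamma_def variance_map_mult power_mult_distrib)
qed

theorem mainTheorem1:
  fixes \<sigma> :: real and k :: nat and sample B Y :: "real list"
  assumes "\<sigma> > 0"
    and "k > 0"
    and "k \<le> length sample"
    and "B = k_smallest k sample"
    and "\<exists>i<k. \<exists>j<k. B ! i \<noteq> B ! j"
    and "Y = k_smallest k (map (\<lambda>x. \<sigma> * x) sample)"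
  shows "gamma Y = gamma B"
proof -
  have len: "length B = k" "length Y = k"
    using assms(3,4,6) by (simp_all add: k_smallest_def)
  \<comment> \<open>The entrywise identity \<open>k_smallest_scale\<close> becomes an equality of
    lists, as both have length \<open>k\<close>.\<close>
  have "Y = map (\<lambda>x. \<sigma> * x) B"
    using len assms(4,6) k_smallest_scale[OF assms(1,3)] by (intro nth_equalityI) simp_all
  moreover have "B \<noteq> []"
    using len(1) assms(2) by auto
  ultimately show ?thesis
    using assms(1) by (simp add: gamma_map_mult)
qed

end
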